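(* Let $\omega=e^{2\pi i/3}$. For any $\theta\in[-\tfrac12\pi,\tfrac12\pi)$, the six points $$[0,1,-\omega],\quad [0,1,-\omega^2]\in C_1,$$ $$[1,0,-\omega]=\mathbf z[-\tfrac23\pi,-\tfrac16\pi],\quad [1,0,-\omega^2]=\mathbf z[\tfrac23\pi,-\tfrac16\pi]\in C_2,$$ $$[1,-\omega,0]=\mathbf z[-\tfrac23\pi,\tfrac16\pi],\quad [1,-\omega^2,0]=\mathbf z[\tfrac23\pi,\tfrac16\pi]\in C_3,$$ combine with the three points $$\mathbf z[0,\theta-\tfrac13\pi],\qquad \mathbf z[0,\theta],\qquad \mathbf z[0,\theta+\tfrac13\pi]$$ to form a SIC set in $\mathbb{CP}^2$ that is isometric to a midpoint solution.
   Context: For $\mathbf z\in\mathbb C^3\setminus\{0\}$, $[\mathbf z]=[z_1,z_2,z_3]$ denotes the corresponding point of $\mathbb{CP}^2$, and $\langle\mathbf w,\mathbf z\rangle=\sum_i\overline{w_i}z_i$. For real $\sigma,\phi$, $\mathbf z[\sigma,\phi]\in\mathbb{CP}^2$ denotes the point $$\mathbf z[\sigma,\phi]=\big[e^{i\sigma}\cos\phi,\ \cos(\phi+\tfrac23\pi),\ \cos(\phi+\tfrac43\pi)\big].$$ A SIC set in $\mathbb{CP}^2$ is a set of nine distinct points, represented by unit vectors $\mathbf z_1,\dots,\mathbf z_9$, which are mutually equidistant: $|\langle\mathbf z_i,\mathbf z_j\rangle|^2=\kappa$ for all $i\neq j$, for some fixed $\kappa\in[0,1)$ (necessarily $\kappa=1/4$).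 Let $C_1=\{[0,z_2,z_3]:|z_2|=|z_3|\neq0\}$, $C_2=\{[z_1,0,z_3]:|z_1|=|z_3|\ne0\}$, $C_3=\{[z_1,z_2,0]:|z_1|=|z_2|\ne0\}$. A midpoint solution is a SIC set in $\mathbb{CP}^2$ consisting of three points in each of $C_1,C_2,C_3$. Two subsets of $\mathbb{CP}^2$ are isometric if one is the image of the other under an isometry of $\mathbb{CP}^2$, i.e. a bijection preserving the distance $d([\mathbf w],[\mathbf z])=2\arccos\big(|\langle\mathbf w,\mathbf z\rangle|/(\|\mathbf w\|\|\mathbf z\|)\big)$; the group of isometries is generated by the action of $SU(3)$ and complex conjugation $[\mathbf z]\mapsto[\overline{\mathbf z}]$. *)

theory Defs
  imports "HOL-Analysis.Analysis"
begin

definition herm :: "complex^3 \<Rightarrow> complex^3 \<Rightarrow> complex" where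
  "herm w z = (\<Sum>i\<in>UNIV. cnj (w $ i) * z $ i)"

definition proj_rel :: "complex^3 \<Rightarrow> complex^3 \<Rightarrow> bool" where
  "proj_rel w z \<longleftrightarrow> w \<noteq> 0 \<and> z \<noteq> 0 \<and> (\<exists>c. w = c *s z)"

lemma proj_rel_part_equivp: "part_equivp proj_rel"
proof (rule part_equivpI)
  show "\<exists>x. proj_rel x x"
  proof
    have "axis 1 1 = 1 *s (axis 1 1 :: complex^3)" by (rule vector_smult_lid[symmetric])
    moreover have "(axis 1 1 :: complex^3) \<noteq> 0" by (simp add: axis_eq_0_iff)
    ultimately show "proj_rel (axis 1 1) (axis 1 1)" unfolding proj_rel_def by blast
  qed
  show "symp proj_rel"
  proof (rule sympI)
    fix x y assume "proj_rel x y"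
    then obtain c where c: "x \<noteq> 0" "y \<noteq> 0" "x = c *s y"
      by (auto simp: proj_rel_def)
    then have "c \<noteq> 0" by auto
    then have "y = inverse c *s x"
      unfolding c(3) by (simp add: vector_smult_assoc)
    then show "proj_rel y x" using c(1,2) unfolding proj_rel_def by blast
  qed
  show "transp proj_rel"
    by (rule transpI) (auto simp: proj_rel_def vector_smult_assoc)
qed

text \<open>
  The relation is reflexive only on nonzero vectors, so the quotient is
  \<open>\<complex>P\<^sup>2\<close>. For \<open>z \<noteq> 0\<close> the class \<open>[z]\<close> is \<open>proj z\<close>; the value \<open>proj 0\<close> is unspecified.
\<close>

quotient_type cp2 = "complex^3" / partial: proj_rel
  morphisms rep_cp2 proj
  by (rule proj_rel_part_equivp)

lemma proj_eq_iff:
  assumes "w \<noteq> 0" "z \<noteq> 0"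
  shows "proj w = proj z \<longleftrightarrow> (\<exists>c. w = c *s z)"
proof -
  have refl: "proj_rel x x" if "x \<noteq> 0" for x
    using that by (metis proj_rel_def vector_smult_lid)
  have "proj w = proj z \<longleftrightarrow> proj_rel w z"
    using Quotient3_rel[OF Quotient3_cp2, of w z] refl assms by blast
  then show ?thesis
    using assms by (simp add: proj_rel_def)
qed

lemma cp2_cases:
  obtains z where "z \<noteq> 0" "p = proj z"
proof
  show "p = proj (rep_cp2 p)"
    by (rule Quotient3_abs_rep[OF Quotient3_cp2, symmetric])
  show "rep_cp2 p \<noteq> 0"
    using Quotient3_rep_reflp[OF Quotient3_cp2, of p] by (simp add: proj_rel_def)
qed

lemma norm_smult_vec: "norm (c *s (z :: complex^3)) = cmod c * norm z"
  by (simp add: norm_vec_def norm_mult L2_set_right_distrib)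

lift_definition cp2_dist :: "cp2 \<Rightarrow> cp2 \<Rightarrow> real" is
  "\<lambda>w z. 2 * arccos (cmod (herm w z) / (norm w * norm z))"
proof -
  fix w w' z z' :: "complex^3"
  assume "proj_rel w w'" "proj_rel z z'"
  then obtain c d where w: "w = c *s w'" "w \<noteq> 0" and z: "z = d *s z'" "z \<noteq> 0"
    by (auto simp: proj_rel_def)
  then have nz: "c \<noteq> 0" "d \<noteq> 0" by auto
  have "herm w z = cnj c * d * herm w' z'"
    by (simp add: herm_def w z sum_distrib_left mult_ac)
  then have "cmod (herm w z) / (norm w * norm z) = cmod (herm w' z') / (norm w' * norm z')"
    using nz by (simp add: w z norm_smult_vec norm_mult field_simps)
  then show "2 * arccos (cmod (herm w z) / (norm w * norm z)) =
      2 * arccos (cmod (herm w' z') / (norm w' * norm z'))" by simp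
qed

lemma cp2_dist_proj:
  assumes "w \<noteq> 0" "z \<noteq> 0"
  shows "cp2_dist (proj w) (proj z) = 2 * arccos (cmod (herm w z) / (norm w * norm z))"
proof -
  have "proj_rel w w" "proj_rel z z"
    using assms by (metis proj_rel_def vector_smult_lid)+
  then show ?thesis by (rule cp2_dist.abs_eq)
qed

definition cp2_isometry :: "(cp2 \<Rightarrow> cp2) \<Rightarrow> bool" where
  "cp2_isometry f \<longleftrightarrow> bij f \<and> (\<forall>p q. cp2_dist (f p) (f q) = cp2_dist p q)"

definition isometric :: "cp2 set \<Rightarrow> cp2 set \<Rightarrow> bool" where
  "isometric S T \<longleftrightarrow> (\<exists>f. cp2_isometry f \<and> f ` S = T)"

definition SIC_set :: "cp2 set \<Rightarrow> bool" where
  "SIC_set S \<longleftrightarrow> (\<exists>(z :: nat \<Rightarrow> complex^3) (\<kappa> :: real).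
     0 \<le> \<kappa> \<and> \<kappa> < 1 \<and>
     (\<forall>i\<in>{1..9}. norm (z i) = 1) \<and>
     inj_on (\<lambda>i. proj (z i)) {1..9} \<and>
     S = (\<lambda>i. proj (z i)) ` {1..9} \<and>
     (\<forall>i\<in>{1..9}. \<forall>j\<in>{1..9}. i \<noteq> j \<longrightarrow> (cmod (herm (z i) (z j)))\<^sup>2 = \<kappa>))"

abbreviation pt :: "complex \<Rightarrow> complex \<Rightarrow> complex \<Rightarrow> cp2" where
  "pt a b c \<equiv> proj (vector [a, b, c])"

definition C1 :: "cp2 set" where
  "C1 = {pt 0 z2 z3 | z2 z3. cmod z2 = cmod z3 \<and> cmod z3 \<noteq> 0}"

definition C2 :: "cp2 set" where
  "C2 = {pt z1 0 z3 | z1 z3. cmod z1 = cmod z3 \<and> cmod z3 \<noteq> 0}"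

definition C3 :: "cp2 set" where
  "C3 = {pt z1 z2 0 | z1 z2. cmod z1 = cmod z2 \<and> cmod z2 \<noteq> 0}"

definition midpoint_solution :: "cp2 set \<Rightarrow> bool" where
  "midpoint_solution S \<longleftrightarrow> SIC_set S \<and> S \<subseteq> C1 \<union> C2 \<union> C3 \<and>
     card (S \<inter> C1) = 3 \<and> card (S \<inter> C2) = 3 \<and> card (S \<inter> C3) = 3"

definition zpt :: "real \<Rightarrow> real \<Rightarrow> cp2" where
  "zpt \<sigma> \<phi> = pt (exp (\<i> * of_real \<sigma>) * of_real (cos \<phi>))
                 (of_real (cos (\<phi> + 2/3 * pi)))
                 (of_real (cos (\<phi> + 4/3 * pi)))"

lemma zpt_nonzero:
  "(vector [exp (\<i> * of_real \<sigma>) * of_real (cos \<phi>), of_real (cos (\<phi> + 2/3 * pi)),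
     of_real (cos (\<phi> + 4/3 * pi))] :: complex^3) \<noteq> 0"
  (is "?v \<noteq> 0")
proof
  assume v: "?v = 0"
  have "exp (\<i> * of_real \<sigma>) * of_real (cos \<phi>) = 0"
    using arg_cong[OF v, of "\<lambda>v. v $ 1"] by (simp only: vector_3 zero_index)
  then have c: "cos \<phi> = 0"
    by (metis exp_not_eq_zero mult_eq_0_iff of_real_eq_0_iff)
  have "complex_of_real (cos (\<phi> + 2/3 * pi)) = 0"
    using arg_cong[OF v, of "\<lambda>v. v $ 2"] by (simp only: vector_3 zero_index)
  then have "cos (\<phi> + 2/3 * pi) = 0"
    by (simp only: of_real_eq_0_iff)
  then have "sin \<phi> * sin (2/3 * pi) = 0"
    unfolding cos_add c by linarith
  moreover have "sin (2/3 * pi) > 0"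
    by (rule sin_gt_zero) auto
  ultimately have "sin \<phi> = 0"
    by (metis less_irrefl mult_eq_0_iff)
  with c show False
    by (metis sin_zero_abs_cos_one abs_zero zero_neq_one)
qed

definition omega :: complex where
  "omega = exp (2 * of_real pi * \<i> / 3)"

end

theory Submission
  imports Defs
begin

text \<open>
  The vectors \<open>z[0,\<phi>]\<close> are real and orthogonal to \<open>(1,1,1)\<close>, so their Fourier transforms
  are \<open>[0, 1, exp (\<plusminus> 2 i \<phi>)]\<close>, which lie in \<open>C\<^sub>1\<close>. The remaining six vectors
  are orthogonal to one of \<open>(1,\<omega>,\<omega>\<^sup>2)\<close> and \<open>(1,\<omega>\<^sup>2,\<omega>)\<close> each, and their transforms are
  distributed evenly over \<open>C\<^sub>2\<close> and \<open>C\<^sub>3\<close>. Hence the Fourier matrix maps the configuration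
  to a midpoint solution.
\<close>

section \<open>Hermitian form, equiangular lists and SIC sets\<close>

lemma herm_3: "herm w z = cnj (w$1) * z$1 + cnj (w$2) * z$2 + cnj (w$3) * z$3"
  by (simp add: herm_def sum_3)

lemma herm_self: "herm z z = of_real ((norm z)\<^sup>2)"
proof -
  have "(norm z)\<^sup>2 = (cmod (z$1))\<^sup>2 + (cmod (z$2))\<^sup>2 + (cmod (z$3))\<^sup>2"
    by (simp add: norm_vec_def L2_set_def sum_3)
  then show ?thesis
    by (simp add: herm_3 complex_norm_square mult.commute del: of_real_power)
qed

lemma cnj_herm: "cnj (herm w z) = herm z w"
  by (simp add: herm_3 mult.commute)

lemma herm_smult: "herm (c *s w) (d *s z) = cnj c * d * herm w z"
  by (simp add: herm_3 algebra_simps)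

text \<open>
  The normalised overlap is \<open>1/4\<close>, written without norms so that it is a ring identity in
  the coordinates and their conjugates.
\<close>

definition equiang :: "complex^3 \<Rightarrow> complex^3 \<Rightarrow> bool" where
  "equiang w z \<longleftrightarrow> 4 * (herm w z * herm z w) = herm w w * herm z z"

lemma equiang_sym: "equiang w z \<longleftrightarrow> equiang z w"
  by (simp add: equiang_def mult.commute)

lemma equiang_cmod:
  assumes "equiang w z"
  shows "4 * (cmod (herm w z))\<^sup>2 = (norm w)\<^sup>2 * (norm z)\<^sup>2"
proof -
  have "complex_of_real (4 * (cmod (herm w z))\<^sup>2) = of_real ((norm w)\<^sup>2 * (norm z)\<^sup>2)"
    using assms unfolding equiang_def herm_self
    by (simp add: complex_norm_square cnj_herm del: of_real_power)
  then show ?thesis by (simp only: of_real_eq_iff)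
qed

text \<open>Proportional vectors attain equality in the Cauchy-Schwarz inequality, so their
  normalised squared overlap is 1 rather than 1/4.\<close>

lemma equiang_proj_neq:
  assumes "equiang w z" "w \<noteq> 0" "z \<noteq> 0"
  shows "proj w \<noteq> proj z"
proof
  assume "proj w = proj z"
  then obtain c where c: "w = c *s z"
    using assms by (auto simp: proj_eq_iff)
  then have "herm w z = cnj c * herm z z"
    using herm_smult[of c z 1 z] by simp
  then have "cmod (herm w z) = norm w * norm z"
    by (simp add: herm_self norm_mult c norm_smult_vec power2_eq_square)
  then show False
    using equiang_cmod[OF assms(1)] assms by (simp add: power_mult_distrib)
qed

lemma distinct_proj:
  assumes "sorted_wrt equiang vs" "0 \<notin> set vs"
  shows "distinct (map proj vs)"
  using assms by (induction vs) (auto dest: equiang_proj_neq)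

text \<open>\<open>sorted_wrt equiang\<close> relates each entry to all later ones; by symmetry of
  \<open>equiang\<close> this covers every pair of distinct positions. Normalising the entries gives
  unit vectors with \<open>\<kappa> = 1/4\<close>.\<close>

lemma SIC_setI:
  assumes vs: "sorted_wrt equiang vs" "0 \<notin> set vs" "length vs = 9"
  shows "SIC_set (proj ` set vs)"
proof -
  \<comment> \<open>Lists are indexed from 0, but \<open>SIC_set\<close> numbers its vectors from 1
    to 9.\<close>
  define v where "v i = vs ! (i - 1)" for i
  define z where "z i = of_real (inverse (norm (v i))) *s v i" for i
  have nz: "v i \<noteq> 0" if "i \<in> {1..9}" for i
  proof -
    have "v i \<in> set vs"
      using that vs(3) unfolding v_def by (intro nth_mem) auto
    then show ?thesis
      using vs(2) by metis
  qed
  have proj_z: "proj (z i) = proj (v i)" if "i \<in> {1..9}" for i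
    using nz[OF that] by (subst proj_eq_iff) (auto simp: z_def)
  have norm_z: "norm (z i) = 1" if "i \<in> {1..9}" for i
    using nz[OF that] by (simp add: z_def norm_smult_vec norm_inverse)
  have lt: "equiang (v i) (v j)" if "i \<in> {1..9}" "j \<in> {1..9}" "i < j" for i j
    unfolding v_def using that vs(3) by (intro sorted_wrt_nth_less[OF vs(1)]) auto
  have eq: "equiang (v i) (v j)" if "i \<in> {1..9}" "j \<in> {1..9}" "i \<noteq> j" for i j
    using that lt equiang_sym by (metis linorder_neqE_nat)
  have ang: "(cmod (herm (z i) (z j)))\<^sup>2 = 1/4" if "i \<in> {1..9}" "j \<in> {1..9}" "i \<noteq> j" for i j
    using equiang_cmod[OF eq[OF that]] nz that
    by (simp add: z_def herm_smult norm_mult norm_inverse norm_divide power_divide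
        power_mult_distrib field_simps)
  have "inj_on (\<lambda>i. proj (z i)) {1..9}"
    using eq nz by (intro inj_onI) (metis equiang_proj_neq proj_z)
  moreover have set_vs: "v ` {1..9} = set vs"
  proof -
    have "set vs = (\<lambda>i. vs ! i) ` {..<9}"
      using vs(3) by (metis atLeast0LessThan nth_image order_refl take_all)
    moreover have "{..<9} = (\<lambda>i. i - 1) ` {1..9::nat}"
      by (auto simp: image_iff intro!: bexI[of _ "Suc _"])
    ultimately show ?thesis
      by (simp add: v_def image_image)
  qed
  have "proj ` set vs = (\<lambda>i. proj (z i)) ` {1..9}"
    unfolding set_vs[symmetric] image_image by (rule image_cong[OF refl proj_z[symmetric]])
  ultimately show ?thesis
    unfolding SIC_set_def using norm_z ang
    by (intro exI[of _ z] exI[of _ "1/4"]) auto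
qed

section \<open>The sets \<open>C1\<close>, \<open>C2\<close>, \<open>C3\<close> and midpoint
  solutions\<close>

text \<open>Which coordinates vanish does not change under a nonzero scalar, so every representative
  has the same zero pattern. The three patterns differ, which makes the sets disjoint.\<close>

lemma C_nonzero_coords:
  assumes "z \<noteq> 0"
  shows "proj z \<in> C1 \<Longrightarrow> z$1 = 0 \<and> z$2 \<noteq> 0 \<and> z$3 \<noteq> 0"
    and "proj z \<in> C2 \<Longrightarrow> z$1 \<noteq> 0 \<and> z$2 = 0 \<and> z$3 \<noteq> 0"
    and "proj z \<in> C3 \<Longrightarrow> z$1 \<noteq> 0 \<and> z$2 \<noteq> 0 \<and> z$3 = 0"
proof -
  have *: "\<exists>c. c \<noteq> 0 \<and> z = c *s w" if "proj z = proj w" "w \<noteq> 0" for w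
    using that assms by (metis proj_eq_iff vector_smult_lzero)
  have nz: "w \<noteq> 0" if "w $ i \<noteq> 0" for w :: "complex^3" and i
    using that by auto
  show "z$1 = 0 \<and> z$2 \<noteq> 0 \<and> z$3 \<noteq> 0" if C: "proj z \<in> C1"
  proof -
    obtain a b where ab: "proj z = pt 0 a b" "cmod a = cmod b" "cmod b \<noteq> 0"
      using C by (auto simp: C1_def)
    then obtain c where "c \<noteq> 0" "z = c *s vector [0, a, b]"
      using *[OF ab(1)] nz[of _ 3] by auto
    then show ?thesis using ab by auto
  qed
  show "z$1 \<noteq> 0 \<and> z$2 = 0 \<and> z$3 \<noteq> 0" if C: "proj z \<in> C2"
  proof -
    obtain a b where ab: "proj z = pt a 0 b" "cmod a = cmod b" "cmod b \<noteq> 0"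
      using C by (auto simp: C2_def)
    then obtain c where "c \<noteq> 0" "z = c *s vector [a, 0, b]"
      using *[OF ab(1)] nz[of _ 3] by auto
    then show ?thesis using ab by auto
  qed
  show "z$1 \<noteq> 0 \<and> z$2 \<noteq> 0 \<and> z$3 = 0" if C: "proj z \<in> C3"
  proof -
    obtain a b where ab: "proj z = pt a b 0" "cmod a = cmod b" "cmod b \<noteq> 0"
      using C by (auto simp: C3_def)
    then obtain c where "c \<noteq> 0" "z = c *s vector [a, b, 0]"
      using *[OF ab(1)] nz[of _ 2] by auto
    then show ?thesis using ab by auto
  qed
qed

lemma C_disjoint: "C1 \<inter> C2 = {}" "C1 \<inter> C3 = {}" "C2 \<inter> C3 = {}"
  using C_nonzero_coords by (metis cp2_cases disjoint_iff)+

lemma proj_in_C1: "z$1 = 0 \<Longrightarrow> cmod (z$2) = cmod (z$3) \<Longrightarrow> z \<noteq> 0 \<Longrightarrow> proj z \<in> C1"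
  unfolding C1_def
  by (rule CollectI, rule exI[of _ "z$2"], rule exI[of _ "z$3"])
     (auto simp: vec_eq_iff forall_3 intro!: arg_cong[of _ _ proj])

lemma proj_in_C2: "z$2 = 0 \<Longrightarrow> cmod (z$1) = cmod (z$3) \<Longrightarrow> z \<noteq> 0 \<Longrightarrow> proj z \<in> C2"
  unfolding C2_def
  by (rule CollectI, rule exI[of _ "z$1"], rule exI[of _ "z$3"])
     (auto simp: vec_eq_iff forall_3 intro!: arg_cong[of _ _ proj])

lemma proj_in_C3: "z$3 = 0 \<Longrightarrow> cmod (z$1) = cmod (z$2) \<Longrightarrow> z \<noteq> 0 \<Longrightarrow> proj z \<in> C3"
  unfolding C3_def
  by (rule CollectI, rule exI[of _ "z$1"], rule exI[of _ "z$2"])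
     (auto simp: vec_eq_iff forall_3 intro!: arg_cong[of _ _ proj])

text \<open>By disjointness, intersecting with one of \<open>C1\<close>, \<open>C2\<close>,
  \<open>C3\<close> recovers exactly the corresponding block. Equiangularity makes the three points
  of a block distinct, which gives the cardinalities.\<close>

lemma midpoint_solutionI:
  assumes vs: "vs = us1 @ us2 @ us3" "sorted_wrt equiang vs" "0 \<notin> set vs"
    and len: "length us1 = 3" "length us2 = 3" "length us3 = 3"
    and C: "proj ` set us1 \<subseteq> C1" "proj ` set us2 \<subseteq> C2" "proj ` set us3 \<subseteq> C3"
  shows "midpoint_solution (proj ` set vs)"
proof -
  have d: "distinct (map proj us1)" "distinct (map proj us2)" "distinct (map proj us3)"
    using distinct_proj[OF vs(2,3)] by (simp_all add: vs(1))
  have "card (proj ` set us) = length us" if "distinct (map proj us)" for us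
    using distinct_card[OF that] by simp
  then have card: "card (proj ` set us1) = 3" "card (proj ` set us2) = 3" "card (proj ` set us3) = 3"
    using d len by auto
  have un: "proj ` set vs = proj ` set us1 \<union> proj ` set us2 \<union> proj ` set us3"
    by (simp add: vs(1) image_Un Un_assoc)
  have "(A \<union> B \<union> C) \<inter> C1 = A \<and> (A \<union> B \<union> C) \<inter> C2 = B \<and> (A \<union> B \<union> C) \<inter> C3 = C"
    if "A \<subseteq> C1" "B \<subseteq> C2" "C \<subseteq> C3" for A B C
    using that C_disjoint by blast
  note int = this[OF C, folded un]
  have "SIC_set (proj ` set vs)"
    using vs len by (intro SIC_setI) simp_all
  moreover have "proj ` set vs \<subseteq> C1 \<union> C2 \<union> C3"
    unfolding un using C by (intro Un_mono)
  ultimately show ?thesis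
    unfolding midpoint_solution_def by (simp only: int card simp_thms)
qed

section \<open>Isometries induced by similarities\<close>

text \<open>\<open>F\<close> multiplies the Hermitian form by \<open>r\<close> and every norm by
  \<open>sqrt r\<close>, so the quotient inside \<open>arccos\<close> does not change. This permits
  a Fourier matrix without the factor \<open>1 / sqrt 3\<close>.\<close>

lemma similarity_induces_isometry:
  fixes F :: "complex^3 \<Rightarrow> complex^3" and r :: real
  assumes hom: "\<And>c z. F (c *s z) = c *s F z"
    and herm: "\<And>w z. herm (F w) (F z) = of_real r * herm w z"
    and r: "r > 0" and bij: "bij F"
  shows "\<exists>f. cp2_isometry f \<and> (\<forall>z. z \<noteq> 0 \<longrightarrow> f (proj z) = proj (F z))"
proof -
  have F0: "F 0 = 0"
    using hom[of 0 0] by simp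
  have nz: "F z \<noteq> 0" if "z \<noteq> 0" for z
    using that F0 bij by (metis bij_def injD)
  \<comment> \<open>\<open>rep_cp2\<close> selects some representative; homogeneity of
    \<open>F\<close> shows that any other one gives the same point.\<close>
  define f where "f p = proj (F (rep_cp2 p))" for p
  have f: "f (proj z) = proj (F z)" if z: "z \<noteq> 0" for z
  proof -
    have "proj_rel z z"
      using z by (metis proj_rel_def vector_smult_lid)
    then have "proj_rel (rep_cp2 (proj z)) z"
      using Quotient3_rep_abs[OF Quotient3_cp2] by blast
    then obtain c where "rep_cp2 (proj z) \<noteq> 0" "rep_cp2 (proj z) = c *s z"
      by (auto simp: proj_rel_def)
    then show ?thesis
      using nz z hom by (metis f_def proj_eq_iff)
  qed
  have norm_F: "norm (F z) = sqrt r * norm z" for z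
  proof -
    have "complex_of_real ((norm (F z))\<^sup>2) = of_real (r * (norm z)\<^sup>2)"
      using herm[of z z] by (simp add: herm_self)
    then have "(norm (F z))\<^sup>2 = (sqrt r * norm z)\<^sup>2"
      using r by (simp only: of_real_eq_iff power_mult_distrib real_sqrt_pow2 less_imp_le)
    then show ?thesis
      using r by (simp add: power2_eq_iff_nonneg)
  qed
  have "cp2_dist (f p) (f q) = cp2_dist p q" for p q
  proof -
    obtain w z where w: "w \<noteq> 0" "p = proj w" and z: "z \<noteq> 0" "q = proj z"
      by (metis cp2_cases)
    have "(sqrt r * norm w) * (sqrt r * norm z) = r * (norm w * norm z)"
      using r by (simp add: mult.assoc mult.left_commute)
    then show ?thesis
      unfolding w(2) z(2) using w(1) z(1) r
      by (simp only: f nz cp2_dist_proj norm_F herm norm_mult not_False_eq_True) simp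
  qed
  moreover have "inj f"
  proof (rule injI)
    fix p q assume "f p = f q"
    moreover obtain w z where w: "w \<noteq> 0" "p = proj w" and z: "z \<noteq> 0" "q = proj z"
      by (metis cp2_cases)
    ultimately obtain c where "F w = c *s F z"
      using nz by (auto simp: f proj_eq_iff)
    then have "F w = F (c *s z)"
      by (simp add: hom)
    then have "w = c *s z"
      using bij by (metis bij_def injD)
    then show "p = q"
      using w z by (auto simp: proj_eq_iff)
  qed
  moreover have "surj f"
  proof (rule surjI[where f = "\<lambda>p. proj (inv F (rep_cp2 p))"])
    fix p
    obtain z where z: "rep_cp2 p = F z"
      using bij by (metis bij_pointE)
    have "rep_cp2 p \<noteq> 0"
      using Quotient3_rep_reflp[OF Quotient3_cp2, of p] by (simp add: proj_rel_def)
    then have "z \<noteq> 0"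
      using z F0 by auto
    moreover have "inv F (rep_cp2 p) = z"
      using bij by (simp add: z bij_is_inj)
    ultimately show "f (proj (inv F (rep_cp2 p))) = p"
      using f z by (metis Quotient3_abs_rep[OF Quotient3_cp2])
  qed
  ultimately show ?thesis
    using f unfolding cp2_isometry_def bij_def by blast
qed

section \<open>The cube root of unity and the Fourier matrix\<close>

lemma omega_Complex: "omega = Complex (-1/2) (sqrt 3 / 2)"
proof -
  have "omega = cis (2 * pi / 3)"
    unfolding omega_def cis_conv_exp by (simp add: field_simps)
  then show ?thesis
    by (simp add: complex_eq_iff cos_120 sin_120)
qed

lemma omega_sq: "omega\<^sup>2 = - 1 - omega"
  by (simp add: omega_Complex complex_eq_iff power2_eq_square)

lemma omega_mult: "omega * omega = - 1 - omega"
  using omega_sq by (simp add: power2_eq_square)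

lemma omega_mult_left: "omega * (omega * a) = (- 1 - omega) * a"
  by (simp flip: omega_mult)

lemma cnj_omega: "cnj omega = - 1 - omega"
  by (simp add: omega_Complex complex_eq_iff)

text \<open>These rules eliminate conjugates and higher powers of \<open>omega\<close>, leaving
  expressions linear in \<open>omega\<close>, so identities over the cube roots of unity reduce to
  \<open>algebra_simps\<close>.\<close>

lemmas omega_simps = omega_sq omega_mult omega_mult_left cnj_omega

text \<open>For \<open>\<zeta> = omega\<close> the coordinates are the pairings of \<open>z\<close>
  with (1,1,1), (1,\<open>omega\<close>,\<open>omega\<^sup>2\<close>) and
  (1,\<open>omega\<^sup>2\<close>,\<open>omega\<close>): the unnormalised discrete Fourier
  transform. The parameter lets \<open>cnj omega\<close> give three times the inverse.\<close>

definition fourier :: "complex \<Rightarrow> complex^3 \<Rightarrow> complex^3" where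
  "fourier \<zeta> z = vector [z$1 + z$2 + z$3, z$1 + \<zeta>\<^sup>2 * z$2 + \<zeta> * z$3, z$1 + \<zeta> * z$2 + \<zeta>\<^sup>2 * z$3]"

lemma fourier_smult: "fourier \<zeta> (c *s z) = c *s fourier \<zeta> z"
  by (simp add: fourier_def vec_eq_iff forall_3 algebra_simps)

text \<open>Since 1 + \<open>omega\<close> + \<open>omega\<^sup>2\<close> = 0, the columns of the
  matrix are orthogonal, each of squared norm 3.\<close>

lemma herm_fourier: "herm (fourier omega w) (fourier omega z) = of_real 3 * herm w z"
  by (simp add: fourier_def herm_3 algebra_simps omega_simps)

lemma fourier_inverse:
  "fourier omega (fourier (cnj omega) z) = 3 *s z"
  "fourier (cnj omega) (fourier omega z) = 3 *s z"
  by (simp_all add: fourier_def vec_eq_iff forall_3 algebra_simps power2_eq_square omega_simps)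

lemma bij_fourier: "bij (fourier omega)"
proof (rule o_bij[where g = "\<lambda>z. (1/3) *s fourier (cnj omega) z"])
  show "(\<lambda>z. (1/3) *s fourier (cnj omega) z) \<circ> fourier omega = id"
    by (simp add: fun_eq_iff fourier_inverse vec_eq_iff)
  show "fourier omega \<circ> (\<lambda>z. (1/3) *s fourier (cnj omega) z) = id"
    by (simp add: fun_eq_iff fourier_smult fourier_inverse vec_eq_iff)
qed

section \<open>The real vectors and their overlaps\<close>

definition rvec :: "real \<Rightarrow> complex^3" where
  "rvec \<phi> = vector [of_real (cos \<phi>), of_real (cos (\<phi> + 2/3 * pi)), of_real (cos (\<phi> + 4/3 * pi))]"

lemma cnj_rvec: "cnj (rvec \<phi> $ i) = rvec \<phi> $ i"
  using exhaust_3[of i] by (auto simp: rvec_def)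

lemma zpt_0: "zpt 0 \<phi> = proj (rvec \<phi>)"
  by (simp add: zpt_def rvec_def)

lemma cos_shift:
  "cos (\<phi> + 2/3 * pi) = - cos \<phi> / 2 - sqrt 3 / 2 * sin \<phi>"
  "cos (\<phi> + 4/3 * pi) = - cos \<phi> / 2 + sqrt 3 / 2 * sin \<phi>"
proof -
  have third: "cos (2/3 * pi) = -1/2" "sin (2/3 * pi) = sqrt 3 / 2"
    using cos_120 sin_120 by simp_all
  have "4/3 * pi = 2/3 * pi + 2/3 * pi" by simp
  then have "cos (4/3 * pi) = -1/2" "sin (4/3 * pi) = - sqrt 3 / 2"
    by (simp_all only: cos_add sin_add third) simp_all
  then show "cos (\<phi> + 4/3 * pi) = - cos \<phi> / 2 + sqrt 3 / 2 * sin \<phi>"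
    by (simp add: cos_add)
  show "cos (\<phi> + 2/3 * pi) = - cos \<phi> / 2 - sqrt 3 / 2 * sin \<phi>"
    by (simp only: cos_add third) simp
qed

text \<open>By \<open>cos_shift\<close>, \<open>rvec \<phi>\<close> is \<open>cos \<phi>\<close>
  times (1,-1/2,-1/2) plus \<open>sin \<phi>\<close> times (0,-sqrt 3/2,sqrt 3/2). These two vectors
  are orthogonal with squared norm 3/2, so \<open>rvec\<close> runs round a circle in a real
  plane.\<close>

lemma herm_rvec: "herm (rvec \<phi>) (rvec \<psi>) = of_real (3/2 * cos (\<phi> - \<psi>))"
proof -
  have "herm (rvec \<phi>) (rvec \<psi>) = of_real (cos \<phi> * cos \<psi> + cos (\<phi> + 2/3 * pi) * cos (\<psi> + 2/3 * pi)
      + cos (\<phi> + 4/3 * pi) * cos (\<psi> + 4/3 * pi))"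
    by (simp add: rvec_def herm_3)
  also have "cos \<phi> * cos \<psi> + cos (\<phi> + 2/3 * pi) * cos (\<psi> + 2/3 * pi)
      + cos (\<phi> + 4/3 * pi) * cos (\<psi> + 4/3 * pi) = 3/2 * cos (\<phi> - \<psi>)"
    unfolding cos_shift cos_diff by (simp add: field_simps)
  finally show ?thesis .
qed

lemma equiang_rvec:
  assumes "(cos (\<phi> - \<psi>))\<^sup>2 = 1/4"
  shows "equiang (rvec \<phi>) (rvec \<psi>)"
proof -
  have "cos (\<psi> - \<phi>) = cos (\<phi> - \<psi>)"
    by (metis cos_minus minus_diff_eq)
  \<comment> \<open>The factor 9 is 4 times the square of 3/2; the squared norms multiply to 9/4,
    hence the required value 1/4 of the squared cosine.\<close>
  then have "4 * (herm (rvec \<phi>) (rvec \<psi>) * herm (rvec \<psi>) (rvec \<phi>)) = of_real (9 * (cos (\<phi> - \<psi>))\<^sup>2)"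
    by (simp add: herm_rvec power2_eq_square)
  then show ?thesis
    unfolding equiang_def assms by (simp add: herm_rvec)
qed

lemma rvec_nonzero: "rvec \<phi> \<noteq> 0"
  using herm_rvec[of \<phi> \<phi>] by (auto simp: herm_3)

lemma rvec_orth: "rvec \<phi> $ 1 + rvec \<phi> $ 2 + rvec \<phi> $ 3 = 0"
proof -
  have "cos \<phi> + cos (\<phi> + 2/3 * pi) + cos (\<phi> + 4/3 * pi) = 0"
    by (simp only: cos_shift)
  then show ?thesis
    unfolding rvec_def by (simp flip: of_real_add)
qed

text \<open>Orthogonality to (1,1,1) kills the first coordinate, and for a real vector the other two
  are complex conjugates, hence of equal modulus.\<close>

lemma fourier_rvec_C1: "proj (fourier omega (rvec \<phi>)) \<in> C1"
proof (rule proj_in_C1)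
  let ?F = "fourier omega (rvec \<phi>)"
  show "?F $ 1 = 0"
    by (simp add: fourier_def rvec_orth)
  have "?F $ 3 = cnj (?F $ 2)"
    by (simp add: fourier_def cnj_rvec omega_simps algebra_simps)
  then show "cmod (?F $ 2) = cmod (?F $ 3)" by simp
  have "herm ?F ?F \<noteq> 0"
    by (simp add: herm_fourier herm_rvec)
  then show "?F \<noteq> 0" by (auto simp: herm_3)
qed

text \<open>As the coordinates sum to 0, eliminating one of them turns the sum of squares 3/2 into
  twice the quadratic form in the other two.\<close>

lemma rvec_quadratic:
  "(rvec \<phi> $ 2)\<^sup>2 + rvec \<phi> $ 2 * rvec \<phi> $ 3 + (rvec \<phi> $ 3)\<^sup>2 = 3/4"
  "(rvec \<phi> $ 1)\<^sup>2 + rvec \<phi> $ 1 * rvec \<phi> $ 3 + (rvec \<phi> $ 3)\<^sup>2 = 3/4"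
  "(rvec \<phi> $ 1)\<^sup>2 + rvec \<phi> $ 1 * rvec \<phi> $ 2 + (rvec \<phi> $ 2)\<^sup>2 = 3/4"
proof -
  have sq: "(rvec \<phi> $ 1)\<^sup>2 + (rvec \<phi> $ 2)\<^sup>2 + (rvec \<phi> $ 3)\<^sup>2 = 3/2"
    using herm_rvec[of \<phi> \<phi>] by (simp add: herm_3 cnj_rvec power2_eq_square)
  have *: "a\<^sup>2 + a * b + b\<^sup>2 = 3/4" if "c + a + b = 0" "c\<^sup>2 + a\<^sup>2 + b\<^sup>2 = 3/2" for a b c :: complex
  proof -
    have c: "c = - (a + b)"
      using that(1) by (metis add.assoc eq_neg_iff_add_eq_0)
    have "2 * (a\<^sup>2 + a * b + b\<^sup>2) = c\<^sup>2 + a\<^sup>2 + b\<^sup>2"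
      unfolding c by (simp add: power2_eq_square algebra_simps)
    then show ?thesis
      unfolding that(2) by (simp add: mult.commute)
  qed
  show "(rvec \<phi> $ 2)\<^sup>2 + rvec \<phi> $ 2 * rvec \<phi> $ 3 + (rvec \<phi> $ 3)\<^sup>2 = 3/4"
    using rvec_orth sq by (intro *[of "rvec \<phi> $ 1"]) (simp_all add: ac_simps)
  show "(rvec \<phi> $ 1)\<^sup>2 + rvec \<phi> $ 1 * rvec \<phi> $ 3 + (rvec \<phi> $ 3)\<^sup>2 = 3/4"
    using rvec_orth sq by (intro *[of "rvec \<phi> $ 2"]) (simp_all add: ac_simps)
  show "(rvec \<phi> $ 1)\<^sup>2 + rvec \<phi> $ 1 * rvec \<phi> $ 2 + (rvec \<phi> $ 2)\<^sup>2 = 3/4"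
    using rvec_orth sq by (intro *[of "rvec \<phi> $ 3"]) (simp_all add: ac_simps)
qed

text \<open>The overlap has the form \<open>a - \<zeta> * b\<close> with real \<open>a\<close>,
  \<open>b\<close>; its squared modulus is \<open>a\<^sup>2 + a * b + b\<^sup>2\<close> = 3/4, and 4
  * 3/4 equals the product of the squared norms 3/2 and 2. This holds for every
  \<open>\<phi>\<close>, which is why \<open>\<theta>\<close> remains free.\<close>

lemma equiang_rvec_edge:
  assumes "\<zeta> = omega \<or> \<zeta> = omega\<^sup>2"
  shows "equiang (rvec \<phi>) (vector [0, 1, - \<zeta>])"
    and "equiang (rvec \<phi>) (vector [1, 0, - \<zeta>])"
    and "equiang (rvec \<phi>) (vector [1, - \<zeta>, 0])"
proof -
  have \<zeta>: "cnj \<zeta> + \<zeta> = -1" "cnj \<zeta> * \<zeta> = 1"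
    using assms unfolding omega_sq by (safe; simp add: omega_simps algebra_simps)+
  have prod: "(a - cnj \<zeta> * b) * (a - \<zeta> * b) = a\<^sup>2 + a * b + b\<^sup>2" for a b
  proof -
    have "(a - cnj \<zeta> * b) * (a - \<zeta> * b) = a\<^sup>2 - (cnj \<zeta> + \<zeta>) * (a * b) + (cnj \<zeta> * \<zeta>) * b\<^sup>2"
      by (simp add: power2_eq_square algebra_simps)
    then show ?thesis by (simp add: \<zeta>)
  qed
  show "equiang (rvec \<phi>) (vector [0, 1, - \<zeta>])" "equiang (rvec \<phi>) (vector [1, 0, - \<zeta>])"
    "equiang (rvec \<phi>) (vector [1, - \<zeta>, 0])"
    unfolding equiang_def herm_rvec
    using prod[of "rvec \<phi> $ 2" "rvec \<phi> $ 3"] prod[of "rvec \<phi> $ 1" "rvec \<phi> $ 3"]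
      prod[of "rvec \<phi> $ 1" "rvec \<phi> $ 2"]
    by (simp_all add: herm_3 cnj_rvec rvec_quadratic \<zeta> \<zeta>(2)[unfolded mult.commute[of "cnj \<zeta>"]]
        mult.commute)
qed

text \<open>Ordered such that the Fourier transforms lie in \<open>C1\<close>, \<open>C2\<close>, \<open>C3\<close>, in groups of three.\<close>

definition config :: "real \<Rightarrow> (complex^3) list" where
  "config \<theta> =
    [rvec (\<theta> - 1/3 * pi), rvec \<theta>, rvec (\<theta> + 1/3 * pi)] @
    [vector [0, 1, - omega], vector [1, 0, - omega\<^sup>2], vector [1, - omega, 0]] @
    [vector [0, 1, - omega\<^sup>2], vector [1, 0, - omega], vector [1, - omega\<^sup>2, 0]]"

section \<open>The nine vectors and their Fourier images\<close>

lemma vector_3_nonzero: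
  "a \<noteq> 0 \<or> b \<noteq> 0 \<or> c \<noteq> 0 \<Longrightarrow> (vector [a, b, c] :: complex^3) \<noteq> 0"
  by (auto simp: vec_eq_iff forall_3)

lemma config_nonzero: "0 \<notin> set (config \<theta>)"
  using rvec_nonzero[symmetric] vector_3_nonzero[symmetric] by (simp add: config_def)

lemma sorted_wrt_config: "sorted_wrt equiang (config \<theta>)"
proof -
  have "(cos (pi/3))\<^sup>2 = 1/4" "(cos (2 * pi/3))\<^sup>2 = 1/4"
    by (simp_all add: cos_60 cos_120 power2_eq_square)
  moreover have "cos (\<theta> - 1/3 * pi - \<theta>) = cos (pi/3)"
    "cos (\<theta> - (\<theta> + 1/3 * pi)) = cos (pi/3)"
    "cos (\<theta> - 1/3 * pi - (\<theta> + 1/3 * pi)) = cos (2 * pi/3)"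
    using cos_minus[of "pi/3"] cos_minus[of "2 * pi/3"] by simp_all
  ultimately have "equiang (rvec (\<theta> - 1/3 * pi)) (rvec \<theta>)"
    "equiang (rvec \<theta>) (rvec (\<theta> + 1/3 * pi))"
    "equiang (rvec (\<theta> - 1/3 * pi)) (rvec (\<theta> + 1/3 * pi))"
    by (simp_all only: equiang_rvec)
  then show ?thesis
    unfolding config_def
    by (simp only: append_Cons append_Nil sorted_wrt.simps list.set ball_simps simp_thms
          equiang_rvec_edge)
       \<comment> \<open>What remains are the pairs among the six fixed vectors, each an identity in
         \<open>omega\<close>.\<close>
       (intro conjI; simp add: equiang_def herm_3 omega_simps algebra_simps)
qed

text \<open>All nonzero entries are written as \<open>1 - omega\<close>, its negative or a conjugate
  of these, so that equality of moduli is visible without computing them.\<close>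

lemma fourier_edges:
  "fourier omega (vector [0, 1, - omega]) = vector [1 - omega, 0, omega - 1]"
  "fourier omega (vector [1, 0, - omega\<^sup>2]) = vector [cnj (1 - omega), 0, 1 - omega]"
  "fourier omega (vector [1, - omega, 0]) = vector [1 - omega, 0, cnj (1 - omega)]"
  "fourier omega (vector [0, 1, - omega\<^sup>2]) = vector [cnj (1 - omega), cnj (omega - 1), 0]"
  "fourier omega (vector [1, 0, - omega]) = vector [1 - omega, cnj (1 - omega), 0]"
  "fourier omega (vector [1, - omega\<^sup>2, 0]) = vector [cnj (1 - omega), 1 - omega, 0]"
  by (simp_all add: fourier_def vec_eq_iff forall_3 omega_simps algebra_simps)

lemma midpoint_solution_fourier_config:
  "midpoint_solution (proj ` set (map (fourier omega) (config \<theta>)))"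
proof (rule midpoint_solutionI)
  let ?F = "fourier omega"
  show "map ?F (config \<theta>) =
    map ?F [rvec (\<theta> - 1/3 * pi), rvec \<theta>, rvec (\<theta> + 1/3 * pi)] @
    map ?F [vector [0, 1, - omega], vector [1, 0, - omega\<^sup>2], vector [1, - omega, 0]] @
    map ?F [vector [0, 1, - omega\<^sup>2], vector [1, 0, - omega], vector [1, - omega\<^sup>2, 0]]"
    by (simp add: config_def)
  \<comment> \<open>Both sides of the defining equation acquire the same factor 9.\<close>
  have "equiang (?F w) (?F z) \<longleftrightarrow> equiang w z" for w z
    by (simp add: equiang_def herm_fourier)
  then show "sorted_wrt equiang (map ?F (config \<theta>))"
    by (simp add: sorted_wrt_map sorted_wrt_config)
  have one_neq_omega: "1 \<noteq> omega" "omega \<noteq> 1"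
    by (simp_all add: omega_Complex complex_eq_iff)
  have nz: "?F z \<noteq> 0" if "z \<noteq> 0" for z
    using that bij_fourier fourier_smult[of omega 0 0] by (metis bij_def injD vector_smult_lzero)
  then show "0 \<notin> set (map ?F (config \<theta>))"
    using config_nonzero by (metis image_iff list.set_map)
  show "proj ` set (map ?F [rvec (\<theta> - 1/3 * pi), rvec \<theta>, rvec (\<theta> + 1/3 * pi)]) \<subseteq> C1"
    by (simp add: fourier_rvec_C1)
  show "proj ` set (map ?F [vector [0, 1, - omega], vector [1, 0, - omega\<^sup>2], vector [1, - omega, 0]]) \<subseteq> C2"
    using norm_minus_commute[of omega 1] one_neq_omega
    by (auto intro!: proj_in_C2 vector_3_nonzero
        simp: fourier_edges complex_mod_cnj simp del: complex_cnj_diff)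
  show "proj ` set (map ?F [vector [0, 1, - omega\<^sup>2], vector [1, 0, - omega], vector [1, - omega\<^sup>2, 0]]) \<subseteq> C3"
    using norm_minus_commute[of omega 1] one_neq_omega
    by (auto intro!: proj_in_C3 vector_3_nonzero
        simp: fourier_edges complex_mod_cnj simp del: complex_cnj_diff)
qed simp_all

text \<open>At \<open>\<phi>\<close> = -pi/6 the second cosine vanishes and at pi/6 the third; the
  remaining one is the negative of \<open>cos \<phi>\<close>. Dividing by the first coordinate
  leaves minus the inverse of the phase, so the two cube roots swap.\<close>

lemma zpt_edges:
  "zpt (- (2/3) * pi) (- (1/6) * pi) = pt 1 0 (- omega)"
  "zpt (2/3 * pi) (- (1/6) * pi) = pt 1 0 (- omega\<^sup>2)"
  "zpt (- (2/3) * pi) (1/6 * pi) = pt 1 (- omega) 0"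
  "zpt (2/3 * pi) (1/6 * pi) = pt 1 (- omega\<^sup>2) 0"
proof -
  have e: "exp (\<i> * of_real (- (2/3) * pi)) = omega\<^sup>2" "exp (\<i> * of_real (2/3 * pi)) = omega"
    unfolding cis_conv_exp[symmetric] omega_sq
    using cos_120 sin_120 by (simp_all add: omega_Complex complex_eq_iff)
  have c: "cos (- (1/6) * pi) = sqrt 3 / 2" "cos (1/6 * pi) = sqrt 3 / 2"
    "sin (- (1/6) * pi) = - 1/2" "sin (1/6 * pi) = 1/2"
    using cos_30 sin_30 by simp_all
  have cube: "omega * omega\<^sup>2 = 1"
    by (simp add: omega_simps algebra_simps)
  have *: "pt (u * a) b d = pt 1 b' d'"
    if "u * a \<noteq> 0" "b = u * a * b'" "d = u * a * d'" for u a b d b' d'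
    using that vector_3_nonzero
    by (subst proj_eq_iff) (auto simp: vec_eq_iff forall_3 intro!: exI[of _ "u * a"])
  show "zpt (- (2/3) * pi) (- (1/6) * pi) = pt 1 0 (- omega)"
    "zpt (2/3 * pi) (- (1/6) * pi) = pt 1 0 (- omega\<^sup>2)"
    "zpt (- (2/3) * pi) (1/6 * pi) = pt 1 (- omega) 0"
    "zpt (2/3 * pi) (1/6 * pi) = pt 1 (- omega\<^sup>2) 0"
    unfolding zpt_def e cos_shift c using cube
    by (intro *; auto simp: field_simps)+
qed

theorem proposition6p2:
  fixes \<theta> :: real
  assumes "- (1/2) * pi \<le> \<theta>" "\<theta> < 1/2 * pi"
  shows "pt 0 1 (- omega) \<in> C1 \<and> pt 0 1 (- omega\<^sup>2) \<in> C1 \<and>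
    pt 1 0 (- omega) = zpt (- (2/3) * pi) (- (1/6) * pi) \<and> pt 1 0 (- omega) \<in> C2 \<and>
    pt 1 0 (- omega\<^sup>2) = zpt (2/3 * pi) (- (1/6) * pi) \<and> pt 1 0 (- omega\<^sup>2) \<in> C2 \<and>
    pt 1 (- omega) 0 = zpt (- (2/3) * pi) (1/6 * pi) \<and> pt 1 (- omega) 0 \<in> C3 \<and>
    pt 1 (- omega\<^sup>2) 0 = zpt (2/3 * pi) (1/6 * pi) \<and> pt 1 (- omega\<^sup>2) 0 \<in> C3 \<and>
    (let S = {pt 0 1 (- omega), pt 0 1 (- omega\<^sup>2),
              pt 1 0 (- omega), pt 1 0 (- omega\<^sup>2),
              pt 1 (- omega) 0, pt 1 (- omega\<^sup>2) 0,
              zpt 0 (\<theta> - 1/3 * pi), zpt 0 \<theta>, zpt 0 (\<theta> + 1/3 * pi)}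
     in SIC_set S \<and> (\<exists>M. midpoint_solution M \<and> isometric S M))"
proof -
  let ?S = "{pt 0 1 (- omega), pt 0 1 (- omega\<^sup>2),
              pt 1 0 (- omega), pt 1 0 (- omega\<^sup>2),
              pt 1 (- omega) 0, pt 1 (- omega\<^sup>2) 0,
              zpt 0 (\<theta> - 1/3 * pi), zpt 0 \<theta>, zpt 0 (\<theta> + 1/3 * pi)}"
  have S: "?S = proj ` set (config \<theta>)"
  proof -
    \<comment> \<open>This permutation passes from the order of the statement to that of
      \<open>config\<close>.\<close>
    have "{a,b,c,d,e,f,g,h,i} = {g,h,i,a,d,e,b,c,f}" for a b c d e f g h i :: cp2
      by auto
    then show ?thesis
      unfolding config_def zpt_0 append_Cons append_Nil list.set image_insert image_empty .
  qed
  have "SIC_set ?S"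
    unfolding S by (rule SIC_setI[OF sorted_wrt_config config_nonzero]) (simp add: config_def)
  moreover have "isometric ?S (proj ` set (map (fourier omega) (config \<theta>)))"
  proof -
    obtain f where f: "cp2_isometry f" "\<And>z. z \<noteq> 0 \<Longrightarrow> f (proj z) = proj (fourier omega z)"
      using similarity_induces_isometry[OF fourier_smult herm_fourier _ bij_fourier] by auto
    have "f (proj z) = proj (fourier omega z)" if "z \<in> set (config \<theta>)" for z
      using that config_nonzero f(2) by metis
    then have "f ` ?S = proj ` set (map (fourier omega) (config \<theta>))"
      by (simp only: S set_map image_image cong: image_cong)
    then show ?thesis
      using f(1) unfolding isometric_def by blast
  qed
  moreover have "cmod omega = 1"
    by (simp add: omega_def norm_exp_eq_Re)
  then have "pt 0 1 (- omega) \<in> C1" "pt 0 1 (- omega\<^sup>2) \<in> C1" "pt 1 0 (- omega) \<in> C2"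
    "pt 1 0 (- omega\<^sup>2) \<in> C2" "pt 1 (- omega) 0 \<in> C3" "pt 1 (- omega\<^sup>2) 0 \<in> C3"
    by (auto intro!: proj_in_C1 proj_in_C2 proj_in_C3 vector_3_nonzero simp: norm_power)
  ultimately show ?thesis
    using midpoint_solution_fourier_config[of \<theta>] unfolding Let_def zpt_edges
    by (intro conjI refl exI)
qed

end
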